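(* Let $p$ be a prime and let $k,\lambda$ be non-negative integers, and let $n$ be a positive integer, such that none of $n$, $k$, $k-\lambda$ is divisible by $p$. Let $\mathcal{F}=\{F_1, \ldots , F_n\}$ be a family of subsets of $[n]=\{1,\ldots,n\}$ such that $|F_i|\equiv k \pmod p$ for every $i$, and $|F_i\cap F_j|\equiv \lambda \pmod p$ for each $i\neq j$. Then $k(k-1)\equiv \lambda (n-1) \pmod p$. Moreover, for every $i\in [n]$, the degree $d_i$ of $i$ with respect to $\mathcal{F}$ satisfies $d_i\equiv k \pmod p$.
   Context: The degree $d_i$ of a point $i\in[n]$ with respect to $\mathcal{F}=\{F_1,\ldots,F_n\}$ is the number of indices $j\in[n]$ with $i\in F_j$. *)

theory Defs
  imports "HOL-Number_Theory.Cong" "HOL-Computational_Algebra.Primes"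
begin

text \<open>A family \<open>F\<^sub>1, \<dots>, F\<^sub>n\<close> is a function on indices; only its values on \<open>{1..n}\<close> matter.
  The degree counts indices, not sets.\<close>

definition point_degree :: "nat \<Rightarrow> (nat \<Rightarrow> nat set) \<Rightarrow> nat \<Rightarrow> nat" where
  "point_degree n F i = card {j \<in> {1..n}. i \<in> F j}"

end

theory Submission
  imports Defs "HOL-Library.FuncSet"
begin

text \<open>
  Let \<open>A\<close> be the incidence matrix of the family (rows indexed by the sets), \<open>J\<close> the all-one matrix
  and \<open>d\<close> the vector of degrees. Modulo \<open>p\<close>, the row sums of \<open>A\<close> are \<open>k\<close> and
  \<open>A A\<^sup>T = (k - l) I + l J\<close>, hence \<open>A (k A\<^sup>T - l J) = k (k - l) I\<close>. So \<open>A\<close> is surjective on the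
  finite set of vectors modulo \<open>p\<close>, and therefore injective. With \<open>s = k + l (n - 1)\<close> we
  have \<open>A d = A A\<^sup>T 1 = s 1\<close> and \<open>A 1 = k 1\<close>, so \<open>A (k d - s 1) = 0\<close> and \<open>k d\<^sub>i = s\<close> for every \<open>i\<close>.
  Counting incidences, the degrees add up to \<open>n k\<close>, which gives \<open>n k\<^sup>2 = n s\<close>; cancelling \<open>n\<close> yields the
  first claim, and then cancelling \<open>k\<close> in \<open>k d\<^sub>i = k\<^sup>2\<close> the second.
\<close>

text \<open>As \<open>c\<close> is a unit modulo \<open>m\<close>, the right inverse up to
  \<open>c\<close> makes \<open>M\<close> surjective on the finitely many residue vectors, hence
  injective by counting. This avoids determinants and works for composite \<open>m\<close>
  too.\<close>

lemma cong_right_invertible_imp_kernel_trivial: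
  fixes M N :: "'a \<Rightarrow> 'a \<Rightarrow> int" and x :: "'a \<Rightarrow> int"
  assumes fin: "finite I" and m: "m > 0" and c: "coprime c m"
    and MN: "\<And>i l. i \<in> I \<Longrightarrow> l \<in> I \<Longrightarrow>
      [(\<Sum>j\<in>I. M i j * N j l) = (if i = l then c else 0)] (mod m)"
    and ker: "\<And>i. i \<in> I \<Longrightarrow> [(\<Sum>j\<in>I. M i j * x j) = 0] (mod m)"
    and j: "j \<in> I"
  shows "[x j = 0] (mod m)"
proof -
  \<comment> \<open>Extensional functions represent each residue vector exactly once, so
    \<open>S\<close> is finite and equality in it is congruence on \<open>I\<close>.\<close>
  define S where "S = I \<rightarrow>\<^sub>E {0..<m}"
  define f where "f v = restrict (\<lambda>i. (\<Sum>j\<in>I. M i j * v j) mod m) I" for v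
  have finS: "finite S"
    unfolding S_def by (intro finite_PiE fin) auto
  \<comment> \<open>\<open>f\<close> sees only residues on \<open>I\<close>, so preimages and kernel
    vectors may be written unreduced and moved into \<open>S\<close> afterwards.\<close>
  have f_mod: "f (restrict (\<lambda>j. v j mod m) I) = f v" for v
  proof -
    have "[(\<Sum>j\<in>I. M i j * restrict (\<lambda>j. v j mod m) I j) = (\<Sum>j\<in>I. M i j * v j)] (mod m)" for i
      by (intro cong_sum cong_mult) (auto simp: cong_def)
    then show ?thesis
      unfolding f_def by (intro restrict_ext) (auto simp: cong_def)
  qed
  have fS: "f ` S \<subseteq> S"
    using m by (auto simp: f_def S_def)
  obtain d where d: "[c * d = 1] (mod m)"
    using c cong_solve_coprime_int by blast
  have "y \<in> f ` S" if y: "y \<in> S" for y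
  proof -
    \<comment> \<open>The preimage of \<open>y\<close> is \<open>N\<close> applied to
      \<open>y / c\<close>, where \<open>d\<close> inverts \<open>c\<close> modulo
      \<open>m\<close>.\<close>
    define v where "v j = (\<Sum>l\<in>I. N j l * (d * y l))" for j
    have "[(\<Sum>j\<in>I. M i j * v j) = y i] (mod m)" if i: "i \<in> I" for i
    proof -
      have "(\<Sum>j\<in>I. M i j * v j) = (\<Sum>j\<in>I. \<Sum>l\<in>I. (M i j * N j l) * (d * y l))"
        unfolding v_def by (simp add: sum_distrib_left mult.assoc)
      also have "\<dots> = (\<Sum>l\<in>I. (\<Sum>j\<in>I. M i j * N j l) * (d * y l))"
        by (subst sum.swap) (simp add: sum_distrib_right)
      also have "[\<dots> = (\<Sum>l\<in>I. (if i = l then c else 0) * (d * y l))] (mod m)"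
        by (intro cong_sum cong_mult MN i) auto
      also have "(\<Sum>l\<in>I. (if i = l then c else 0) * (d * y l)) = (\<Sum>l\<in>I. if i = l then c * (d * y l) else 0)"
        by (intro sum.cong) auto
      also have "\<dots> = (c * d) * y i"
        using fin i by simp
      also have "[\<dots> = 1 * y i] (mod m)"
        by (intro cong_mult d) auto
      finally show ?thesis by simp
    qed
    then have "f v = y"
      using y unfolding f_def S_def by (auto simp: fun_eq_iff cong_def PiE_iff extensional_def)
    moreover have "restrict (\<lambda>j. v j mod m) I \<in> S"
      using m by (auto simp: S_def)
    ultimately show ?thesis
      using f_mod[of v] by (metis image_eqI)
  qed
  then have "f ` S = S"
    using fS by blast
  then have inj: "inj_on f S"
    using finS by (simp add: eq_card_imp_inj_on)
  have "f x = f (\<lambda>_. 0)"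
    unfolding f_def using ker by (intro restrict_ext) (simp add: cong_def)
  then have "f (restrict (\<lambda>j. x j mod m) I) = f (restrict (\<lambda>j. 0 mod m) I)"
    by (simp only: f_mod)
  moreover have "restrict (\<lambda>j. x j mod m) I \<in> S" "restrict (\<lambda>j. 0 mod m) I \<in> S"
    using m by (auto simp: S_def)
  ultimately have "restrict (\<lambda>j. x j mod m) I = restrict (\<lambda>j. 0 mod m) I"
    using inj by (meson inj_onD)
  then show ?thesis
    using j by (metis cong_def restrict_apply')
qed

theorem theorem8:
  fixes p k l n :: nat and F :: "nat \<Rightarrow> nat set"
  assumes "prime p"
    and "n > 0"
    and "\<not> p dvd n"
    and "\<not> p dvd k"
    and "\<not> int p dvd int k - int l"
    and "\<And>i. i \<in> {1..n} \<Longrightarrow> F i \<subseteq> {1..n}"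
    and "\<And>i. i \<in> {1..n} \<Longrightarrow> [card (F i) = k] (mod p)"
    and "\<And>i j. i \<in> {1..n} \<Longrightarrow> j \<in> {1..n} \<Longrightarrow> i \<noteq> j \<Longrightarrow> [card (F i \<inter> F j) = l] (mod p)"
  shows "[int k * (int k - 1) = int l * (int n - 1)] (mod int p) \<and>
    (\<forall>i\<in>{1..n}. [point_degree n F i = k] (mod p))"
proof -
  define I where "I = {1..n}"
  define P K L where "P = int p" and "K = int k" and "L = int l"
  define A :: "nat \<Rightarrow> nat \<Rightarrow> int" where "A i j = of_bool (j \<in> F i)" for i j
  \<comment> \<open>The row sum of \<open>A A\<^sup>T\<close> modulo \<open>P\<close>: one diagonal
    entry \<open>K\<close> and \<open>n - 1\<close> entries \<open>L\<close>.\<close>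
  define s where "s = K + L * (int n - 1)"
  define deg where "deg j = (\<Sum>i\<in>I. A i j)" for j
  have pos: "P > 0"
    using assms(1) by (auto simp: P_def prime_gt_0_nat)
  have cop: "coprime (int n) P" "coprime K P" "coprime (K - L) P"
    unfolding coprime_commute[of _ P] using assms(1,3-5)
    by (auto intro!: prime_imp_coprime simp: P_def K_def L_def)
  have deg_eq: "deg j = int (point_degree n F j)" for j
    by (simp add: deg_def A_def point_degree_def I_def of_bool_def sum.If_cases Int_def)
  have row: "[(\<Sum>j\<in>I. A i j) = K] (mod P)" if "i \<in> I" for i
  proof -
    have "(\<Sum>j\<in>I. A i j) = int (card (I \<inter> F i))"
      by (simp add: A_def I_def of_bool_def sum.If_cases)
    also have "I \<inter> F i = F i"
      using assms(6) that by (auto simp: I_def)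
    finally show ?thesis
      using assms(7) that by (simp add: I_def K_def P_def cong_int_iff)
  qed
  have AAT: "[(\<Sum>j\<in>I. A i j * A h j) = (if i = h then K else L)] (mod P)"
    if "i \<in> I" "h \<in> I" for i h
  proof (cases "i = h")
    case True
    have "(\<Sum>j\<in>I. A i j * A h j) = (\<Sum>j\<in>I. A i j)"
      using True by (intro sum.cong) (auto simp: A_def)
    then show ?thesis
      using row that True by simp
  next
    case False
    have "(\<Sum>j\<in>I. A i j * A h j) = (\<Sum>j\<in>I. of_bool (j \<in> F i \<inter> F h))"
      by (intro sum.cong) (auto simp: A_def)
    also have "\<dots> = int (card (I \<inter> (F i \<inter> F h)))"
      by (simp add: I_def of_bool_def sum.If_cases Int_def)
    also have "I \<inter> (F i \<inter> F h) = F i \<inter> F h"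
      using assms(6) that by (auto simp: I_def)
    finally show ?thesis
      using assms(8) that False by (simp add: I_def L_def P_def cong_int_iff)
  qed
  have Adeg: "[(\<Sum>j\<in>I. A i j * deg j) = s] (mod P)" if i: "i \<in> I" for i
  proof -
    have "(\<Sum>j\<in>I. A i j * deg j) = (\<Sum>h\<in>I. \<Sum>j\<in>I. A i j * A h j)"
      unfolding deg_def sum_distrib_left by (rule sum.swap)
    also have "[\<dots> = (\<Sum>h\<in>I. if i = h then K else L)] (mod P)"
      by (intro cong_sum AAT i)
    also have "(\<Sum>h\<in>I. if i = h then K else L) = (\<Sum>h\<in>I. L + (if i = h then K - L else 0))"
      by (intro sum.cong) auto
    also have "\<dots> = s"
      using i by (simp add: I_def s_def sum.distrib algebra_simps)
    finally show ?thesis .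
  qed
  have kdeg: "[K * deg j = s] (mod P)" if j: "j \<in> I" for j
  proof -
    have "[K * deg j - s = 0] (mod P)"
    \<comment> \<open>Since each row of \<open>A\<close> sums to \<open>K\<close>, subtracting
      \<open>L\<close> from every entry of \<open>K A\<^sup>T\<close> lowers each entry of the
      product by \<open>K * L\<close>, which cancels exactly the off-diagonal part.\<close>
    proof (rule cong_right_invertible_imp_kernel_trivial
        [where I = I and c = "K * (K - L)" and M = A and N = "\<lambda>j h. K * A h j - L"])
      fix i h assume ih: "i \<in> I" "h \<in> I"
      have "(\<Sum>j\<in>I. A i j * (K * A h j - L)) = K * (\<Sum>j\<in>I. A i j * A h j) - L * (\<Sum>j\<in>I. A i j)"
        by (simp add: sum_distrib_left sum_subtractf algebra_simps)
      also have "[\<dots> = K * (if i = h then K else L) - L * K] (mod P)"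
        by (intro cong_diff cong_mult AAT row ih) auto
      also have "K * (if i = h then K else L) - L * K = (if i = h then K * (K - L) else 0)"
        by (simp add: algebra_simps)
      finally show "[(\<Sum>j\<in>I. A i j * (K * A h j - L)) = (if i = h then K * (K - L) else 0)] (mod P)" .
    next
      fix i assume i: "i \<in> I"
      have "(\<Sum>j\<in>I. A i j * (K * deg j - s)) = K * (\<Sum>j\<in>I. A i j * deg j) - s * (\<Sum>j\<in>I. A i j)"
        by (simp add: sum_distrib_left sum_subtractf algebra_simps)
      also have "[\<dots> = K * s - s * K] (mod P)"
        by (intro cong_diff cong_mult Adeg row i) auto
      finally show "[(\<Sum>j\<in>I. A i j * (K * deg j - s)) = 0] (mod P)"
        by simp
    qed (use pos cop j in \<open>auto simp: I_def\<close>)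
    then show ?thesis
      by (simp add: cong_iff_dvd_diff)
  qed
  \<comment> \<open>Double counting: sum \<open>kdeg\<close> over all points, then regroup the
    incidences by rows.\<close>
  have "[int n * s = int n * (K * K)] (mod P)"
  proof -
    have "int n * s = (\<Sum>j\<in>I. s)"
      by (simp add: I_def)
    also have "[\<dots> = (\<Sum>j\<in>I. K * deg j)] (mod P)"
      by (intro cong_sum cong_sym[OF kdeg])
    also have "(\<Sum>j\<in>I. K * deg j) = K * (\<Sum>i\<in>I. \<Sum>j\<in>I. A i j)"
      unfolding deg_def by (subst sum.swap) (simp add: sum_distrib_left)
    also have "[\<dots> = K * (\<Sum>i\<in>I. K)] (mod P)"
      by (intro cong_mult cong_sum row) auto
    also have "K * (\<Sum>i\<in>I. K) = int n * (K * K)"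
      by (simp add: I_def)
    finally show ?thesis .
  qed
  then have s: "[s = K * K] (mod P)"
    using cop(1) by (simp add: cong_mult_lcancel)
  \<comment> \<open>Subtract \<open>K\<close> from both sides of \<open>s\<close>.\<close>
  have "[K * (K - 1) = L * (int n - 1)] (mod P)"
    using cong_diff[OF s cong_refl[of K]] by (simp add: s_def algebra_simps cong_sym)
  moreover have "[point_degree n F i = k] (mod p)" if "i \<in> {1..n}" for i
  proof -
    have "[K * deg i = K * K] (mod P)"
      using cong_trans[OF kdeg s] that by (simp add: I_def)
    then have "[deg i = K] (mod P)"
      using cop(2) by (simp add: cong_mult_lcancel)
    then show ?thesis
      by (simp add: deg_eq K_def P_def cong_int_iff)
  qed
  ultimately show ?thesis
    by (simp add: K_def L_def P_def)
qed

end
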